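(* Let $G\subset\mathbb C^m$ be a strongly complete domain and $D\subset\mathbb C^n$ a visible domain. Let $K\Subset G$ be nonempty and let $g:(0,\infty)\to(0,\infty)$ be a function with $\lim_{x\to0}g(x)=0$. Then the family $\mathcal F$ (possibly empty) of Kobayashi isometries $f:G\to D$ such that $$\sup_G(\delta_D\circ f)\le g\Big(\sup_K(\delta_D\circ f)\Big)$$ is uniformly equicontinuous (with respect to the Euclidean distance). In particular, any Kobayashi isometry $f:G\to D$ extends continuously to $\overline G$ and (for this extension) $f(\partial G)\subset\partial D$.
   Context: Let $\mathbb D\subset\mathbb C$ be the open unit disc and $\tanh^{-1}t=\frac12\log\frac{1+t}{1-t}$. For a domain $D\subset\mathbb C^n$, the Lempert function is $l_D(z,w)=\inf\{\tanh^{-1}|\alpha|:\exists\varphi:\mathbb D\to D\text{ holomorphic with }\varphi(0)=z,\ \varphi(\alpha)=w\}$, and the Kobayashi distance $k_D$ is the largest pseudodistance on $D$ not exceeding $l_D$. Set $\delta_D(z)=\mathrm{dist}(z,\partial D)$ (Euclidean distance). A Kobayashi isometry $f:G\to D$ is a map (not assumed surjective) with $k_D(f(z),f(w))=k_G(z,w)$ for all $z,w\in G$. "Complete" means complete with respect to the Kobayashi distance. A real geodesic of $D$ is a curve $\psi:[a,b]\to D$ with $k_D(\psi(s),\psi(t))=|s-t|$ for all $s,t\in[a,b]$. A bounded complete domain $D$ is called visible if for any $\varepsilon>0$ there is $K\Subset D$ that intersects (the image of) every real geodesic $\psi$ of $D$ with Euclidean diameter $\mathrm{diam}(\psi)>\varepsilon$.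 A bounded complete domain $G$ is called strongly complete if for any $p\in\partial G$ and any sequence $(\psi_j)$ of real geodesics of $G$ joining points $z_j,w_j\in G$ with $z_j\to p$ and $w_j\to p$, one has $k_G(o,\psi_j)\to\infty$ for some (hence any) $o\in G$, where $k_G(o,\psi_j)$ denotes the infimum of $k_G(o,u)$ over $u$ in the image of $\psi_j$. *)

theory Defs
  imports "HOL-Complex_Analysis.Complex_Analysis"
begin

definition domain :: "'a::topological_space set \<Rightarrow> bool" where
  "domain D \<longleftrightarrow> open D \<and> connected D \<and> D \<noteq> {}"

text \<open>A map into \<open>\<complex>\<^sup>n\<close> is holomorphic iff each of its components is.\<close>

definition analytic_disc :: "(complex ^ 'n) set \<Rightarrow> (complex \<Rightarrow> complex ^ 'n) \<Rightarrow> bool" where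
  "analytic_disc D \<phi> \<longleftrightarrow>
     (\<forall>i. (\<lambda>\<zeta>. \<phi> \<zeta> $ i) holomorphic_on ball 0 1) \<and> \<phi> ` ball 0 1 \<subseteq> D"

text \<open>The infimum is taken in \<^typ>\<open>ereal\<close>, so that an infimum over no discs would be \<open>\<infinity>\<close>.\<close>

definition lempert :: "(complex ^ 'n) set \<Rightarrow> complex ^ 'n \<Rightarrow> complex ^ 'n \<Rightarrow> ereal" where
  "lempert D z w =
     Inf {ereal (artanh (cmod \<alpha>)) | \<alpha>.
            \<alpha> \<in> ball 0 1 \<and> (\<exists>\<phi>. analytic_disc D \<phi> \<and> \<phi> 0 = z \<and> \<phi> \<alpha> = w)}"

definition pseudodistance_on :: "'a set \<Rightarrow> ('a \<Rightarrow> 'a \<Rightarrow> real) \<Rightarrow> bool" where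
  "pseudodistance_on D d \<longleftrightarrow>
     (\<forall>x\<in>D. \<forall>y\<in>D. 0 \<le> d x y) \<and>
     (\<forall>x\<in>D. d x x = 0) \<and>
     (\<forall>x\<in>D. \<forall>y\<in>D. d x y = d y x) \<and>
     (\<forall>x\<in>D. \<forall>y\<in>D. \<forall>z\<in>D. d x z \<le> d x y + d y z)"

definition pseudodistances_below_lempert ::
    "(complex ^ 'n) set \<Rightarrow> (complex ^ 'n \<Rightarrow> complex ^ 'n \<Rightarrow> real) set" where
  "pseudodistances_below_lempert D =
     {d. pseudodistance_on D d \<and> (\<forall>z\<in>D. \<forall>w\<in>D. ereal (d z w) \<le> lempert D z w)}"

text \<open>
  The largest element of this family is its pointwise supremum; see \<open>kobayashi_greatest\<close> below.
  The value 0 off \<open>D\<close> makes the function fit the library locale \<^locale>\<open>Metric_space\<close>, which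
  asks for nonnegativity and symmetry on the whole type.
\<close>

definition kobayashi :: "(complex ^ 'n) set \<Rightarrow> complex ^ 'n \<Rightarrow> complex ^ 'n \<Rightarrow> real" where
  "kobayashi D z w =
     (if z \<in> D \<and> w \<in> D then SUP d \<in> pseudodistances_below_lempert D. d z w else 0)"

lemma norm_vector_scalar_mult: "norm (c *s (x :: complex ^ 'n)) = cmod c * norm x"
  by (simp add: norm_vec_def L2_set_def norm_mult power_mult_distrib real_sqrt_mult
      flip: sum_distrib_left)

lemma lempert_local_bound:
  assumes "ball a r \<subseteq> D" and "w \<in> ball a (r / 2)"
  shows "lempert D a w \<le> ereal (artanh (1 / 2))"
proof -
  define \<phi> where "\<phi> = (\<lambda>\<zeta>. a + (2 * \<zeta>) *s (w - a))"
  have *: "2 * norm (w - a) < r"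
    using assms(2) by (simp add: dist_norm norm_minus_commute)
  have "\<phi> \<zeta> \<in> D" if "\<zeta> \<in> ball 0 1" for \<zeta>
  proof -
    have "norm ((2 * \<zeta>) *s (w - a)) = cmod \<zeta> * (2 * norm (w - a))"
      by (simp add: norm_vector_scalar_mult norm_mult del: vector_sub_rdistrib vector_ssub_ldistrib)
    also have "\<dots> \<le> 1 * (2 * norm (w - a))"
      using that by (intro mult_right_mono) auto
    finally have "\<phi> \<zeta> \<in> ball a r"
      using * by (simp add: \<phi>_def dist_norm del: vector_sub_rdistrib vector_ssub_ldistrib)
    with assms(1) show ?thesis by blast
  qed
  then have "analytic_disc D \<phi>"
    by (auto simp: analytic_disc_def \<phi>_def intro!: holomorphic_intros)
  moreover have "\<phi> 0 = a" "\<phi> (1 / 2) = w"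
    by (simp_all add: \<phi>_def vec_eq_iff)
  ultimately show ?thesis
    unfolding lempert_def
    by (intro Inf_lower CollectI exI[of _ "1 / 2"] conjI exI[of _ \<phi>]) auto
qed

lemma bdd_above_pseudodistances:
  assumes D: "domain D" and z: "z \<in> D" and w: "w \<in> D"
  shows "bdd_above ((\<lambda>d. d z w) ` pseudodistances_below_lempert D)"
proof -
  define R where
    "R x y \<longleftrightarrow> x \<in> D \<and> y \<in> D \<and> (\<exists>B. \<forall>d\<in>pseudodistances_below_lempert D. d x y \<le> B)" for x y
  have "R z w"
  proof (rule connected_equivalence_relation[of D z w R])
    show "connected D" using D by (simp add: domain_def)
    show "z \<in> D" "w \<in> D" by (fact z w)+
    show "R y x" if "R x y" for x y
    proof -
      from that obtain B where B: "\<forall>d\<in>pseudodistances_below_lempert D. d x y \<le> B"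
        and mem: "x \<in> D" "y \<in> D"
        unfolding R_def by blast
      have "d y x = d x y" if "d \<in> pseudodistances_below_lempert D" for d
        using that mem unfolding pseudodistances_below_lempert_def pseudodistance_on_def by blast
      with B have "\<forall>d\<in>pseudodistances_below_lempert D. d y x \<le> B" by metis
      with mem show ?thesis unfolding R_def by blast
    qed
    show "R x y" if "R x u" "R u y" for x u y
    proof -
      from that obtain B C where
        "\<forall>d\<in>pseudodistances_below_lempert D. d x u \<le> B"
        "\<forall>d\<in>pseudodistances_below_lempert D. d u y \<le> C"
        and mem: "x \<in> D" "u \<in> D" "y \<in> D"
        unfolding R_def by blast
      moreover have "d x y \<le> d x u + d u y" if "d \<in> pseudodistances_below_lempert D" for d
        using that mem unfolding pseudodistances_below_lempert_def pseudodistance_on_def by blast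
      ultimately have "\<forall>d\<in>pseudodistances_below_lempert D. d x y \<le> B + C"
        by (meson add_mono order_trans)
      with mem show ?thesis unfolding R_def by blast
    qed
    show "\<exists>T. openin (top_of_set D) T \<and> a \<in> T \<and> (\<forall>x\<in>T. R a x)" if "a \<in> D" for a
    proof -
      obtain r where r: "0 < r" "ball a r \<subseteq> D"
        using D \<open>a \<in> D\<close> openE[of D a] unfolding domain_def by metis
      have sub: "ball a (r / 2) \<subseteq> D"
        using subset_ball[of "r / 2" r a] r by simp
      have "R a x" if "x \<in> ball a (r / 2)" for x
        unfolding R_def
      proof (intro conjI exI ballI)
        show "a \<in> D" "x \<in> D" using \<open>a \<in> D\<close> sub that by auto
        fix d assume "d \<in> pseudodistances_below_lempert D"
        then have "ereal (d a x) \<le> lempert D a x"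
          using \<open>a \<in> D\<close> \<open>x \<in> D\<close> by (auto simp: pseudodistances_below_lempert_def)
        also have "\<dots> \<le> ereal (artanh (1 / 2))"
          using lempert_local_bound[OF r(2) that] .
        finally show "d a x \<le> artanh (1 / 2)" by simp
      qed
      moreover have "openin (top_of_set D) (ball a (r / 2))"
        using sub by (intro open_subset) auto
      ultimately show ?thesis using r by (intro exI[of _ "ball a (r / 2)"]) auto
    qed
  qed
  then show ?thesis by (auto simp: R_def bdd_above_def)
qed

theorem kobayashi_greatest:
  assumes D: "domain D"
  shows "kobayashi D \<in> pseudodistances_below_lempert D"
    and "\<And>d z w. d \<in> pseudodistances_below_lempert D \<Longrightarrow> z \<in> D \<Longrightarrow> w \<in> D \<Longrightarrow>
           d z w \<le> kobayashi D z w"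
proof -
  let ?P = "pseudodistances_below_lempert D"
  show upper: "d z w \<le> kobayashi D z w" if "d \<in> ?P" "z \<in> D" "w \<in> D" for d z w
    using that bdd_above_pseudodistances[OF D, of z w]
    by (auto simp: kobayashi_def intro: cSUP_upper)
  have "artanh (cmod \<alpha>) \<ge> 0" if "cmod \<alpha> < 1" for \<alpha>
    using that by (simp add: artanh_def)
  then have "0 \<le> lempert D z w" for z w
    unfolding lempert_def by (auto intro!: Inf_greatest)
  then have zero: "(\<lambda>_ _. 0) \<in> ?P"
    by (auto simp: pseudodistances_below_lempert_def pseudodistance_on_def zero_ereal_def)
  have least: "kobayashi D z w \<le> c" if "z \<in> D" "w \<in> D" "\<And>d. d \<in> ?P \<Longrightarrow> d z w \<le> c" for z w c
    using that zero by (auto simp: kobayashi_def intro!: cSUP_least)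
  have nonneg: "0 \<le> kobayashi D z w" if "z \<in> D" "w \<in> D" for z w
    using upper[OF zero that] .
  have refl: "kobayashi D z z = 0" if "z \<in> D" for z
    using nonneg[OF that that] least[OF that that, of 0] that
    by (auto simp: pseudodistances_below_lempert_def pseudodistance_on_def intro!: antisym)
  have sym_le: "kobayashi D z w \<le> kobayashi D w z" if "z \<in> D" "w \<in> D" for z w
  proof (rule least)
    fix d assume "d \<in> ?P"
    then have "d z w = d w z"
      using that by (auto simp: pseudodistances_below_lempert_def pseudodistance_on_def)
    with upper[OF \<open>d \<in> ?P\<close> that(2,1)] show "d z w \<le> kobayashi D w z" by simp
  qed (use that in auto)
  have tri: "kobayashi D x z \<le> kobayashi D x y + kobayashi D y z"
    if "x \<in> D" "y \<in> D" "z \<in> D" for x y z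
  proof (rule least)
    fix d assume "d \<in> ?P"
    then have "d x z \<le> d x y + d y z"
      using that unfolding pseudodistances_below_lempert_def pseudodistance_on_def by blast
    with upper[OF \<open>d \<in> ?P\<close> that(1,2)] upper[OF \<open>d \<in> ?P\<close> that(2,3)]
    show "d x z \<le> kobayashi D x y + kobayashi D y z" by simp
  qed (use that in auto)
  have below: "ereal (kobayashi D z w) \<le> lempert D z w" if "z \<in> D" "w \<in> D" for z w
  proof (cases "lempert D z w")
    case (real r)
    then have "kobayashi D z w \<le> r"
      using that by (intro least) (force simp: pseudodistances_below_lempert_def)+
    then show ?thesis using real by simp
  next
    case MInf
    then show ?thesis using \<open>\<And>w z. 0 \<le> lempert D z w\<close>[of z w] by simp
  qed simp
  show "kobayashi D \<in> ?P"
    unfolding pseudodistances_below_lempert_def pseudodistance_on_def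
    using nonneg refl tri below sym_le by (auto intro!: antisym)
qed

definition boundary_dist :: "'a::metric_space set \<Rightarrow> 'a \<Rightarrow> real" where
  "boundary_dist D z = infdist z (frontier D)"

text \<open>
  On a bounded domain the Kobayashi pseudodistance is a distance, so the library's
  \<open>mcomplete\<close> is used at an actual metric space below.
\<close>

definition bounded_complete_domain :: "(complex ^ 'n) set \<Rightarrow> bool" where
  "bounded_complete_domain D \<longleftrightarrow>
     domain D \<and> bounded D \<and> Metric_space.mcomplete D (kobayashi D)"

definition kobayashi_isometry ::
    "(complex ^ 'm) set \<Rightarrow> (complex ^ 'n) set \<Rightarrow> (complex ^ 'm \<Rightarrow> complex ^ 'n) \<Rightarrow> bool" where
  "kobayashi_isometry G D f \<longleftrightarrow>
     f ` G \<subseteq> D \<and> (\<forall>z\<in>G. \<forall>w\<in>G. kobayashi D (f z) (f w) = kobayashi G z w)"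

definition real_geodesic ::
    "(complex ^ 'n) set \<Rightarrow> real \<Rightarrow> real \<Rightarrow> (real \<Rightarrow> complex ^ 'n) \<Rightarrow> bool" where
  "real_geodesic D a b \<psi> \<longleftrightarrow>
     a \<le> b \<and> continuous_on {a..b} \<psi> \<and> \<psi> ` {a..b} \<subseteq> D \<and>
     (\<forall>s\<in>{a..b}. \<forall>t\<in>{a..b}. kobayashi D (\<psi> s) (\<psi> t) = \<bar>s - t\<bar>)"

definition relatively_compact_in :: "'a::topological_space set \<Rightarrow> 'a set \<Rightarrow> bool" where
  "relatively_compact_in K D \<longleftrightarrow> compact (closure K) \<and> closure K \<subseteq> D"

definition visible :: "(complex ^ 'n) set \<Rightarrow> bool" where
  "visible D \<longleftrightarrow> bounded_complete_domain D \<and>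
     (\<forall>\<epsilon>>0. \<exists>K. relatively_compact_in K D \<and>
        (\<forall>a b \<psi>. real_geodesic D a b \<psi> \<and> diameter (\<psi> ` {a..b}) > \<epsilon> \<longrightarrow>
           \<psi> ` {a..b} \<inter> K \<noteq> {}))"

definition strongly_complete :: "(complex ^ 'm) set \<Rightarrow> bool" where
  "strongly_complete G \<longleftrightarrow> bounded_complete_domain G \<and>
     (\<forall>p\<in>frontier G. \<forall>a b \<psi>.
        (\<forall>j::nat. real_geodesic G (a j) (b j) (\<psi> j)) \<and>
        (\<lambda>j. \<psi> j (a j)) \<longlonglongrightarrow> p \<and> (\<lambda>j. \<psi> j (b j)) \<longlonglongrightarrow> p \<longrightarrow>
        (\<exists>o'\<in>G. filterlim (\<lambda>j. INF u \<in> \<psi> j ` {a j..b j}. kobayashi G o' u) at_top sequentially))"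

definition uniformly_equicontinuous_on ::
    "'a::metric_space set \<Rightarrow> ('a \<Rightarrow> 'b::metric_space) set \<Rightarrow> bool" where
  "uniformly_equicontinuous_on S \<F> \<longleftrightarrow>
     (\<forall>\<epsilon>>0. \<exists>\<delta>>0. \<forall>f\<in>\<F>. \<forall>x\<in>S. \<forall>y\<in>S. dist x y < \<delta> \<longrightarrow> dist (f x) (f y) < \<epsilon>)"

end

theory Submission
  imports Defs
begin

text \<open>
  If equicontinuity fails along \<open>f j\<close>, \<open>z j\<close>, \<open>w j\<close>, then \<open>z j\<close> and \<open>w j\<close> may be assumed to converge to
  a common boundary point of \<open>G\<close>. The image under \<open>f j\<close> of a geodesic from \<open>z j\<close> to \<open>w j\<close> is a
  geodesic of \<open>D\<close> of diameter bounded below, so by visibility it meets a fixed compact set in a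
  point \<open>f j (u j)\<close>; by strong completeness \<open>u j\<close> leaves every Kobayashi ball of \<open>G\<close>. Hence
  \<open>f j ` K\<close>, being at bounded distance from \<open>f j o'\<close>, tends to the boundary of \<open>D\<close>, and the
  hypothesis on \<open>g\<close> forces \<open>f j (u j)\<close> to do the same, a contradiction.

  The geodesics come from a Hopf--Rinow argument: the Kobayashi distance is inner and, under strong
  completeness, its closed balls are compact.
\<close>

subsection \<open>Discs and bounds for the Kobayashi distance\<close>

lemma tanh_artanh_real:
  assumes "\<bar>x\<bar> < (1::real)"
  shows "tanh (artanh x) = x"
proof -
  have "exp (- 2 * artanh x) = (1 - x) / (1 + x)"
    using assms by (simp add: artanh_def exp_minus abs_less_iff divide_simps)
  moreover have "(1 - (1 - x) / (1 + x)) / (1 + (1 - x) / (1 + x)) = x"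
    using assms by (simp add: divide_simps)
  ultimately show ?thesis
    by (simp only: tanh_real_altdef)
qed

text \<open>Turns the bounds by \<open>cmod \<alpha>\<close> that the Schwarz lemma gives into
  bounds by \<open>artanh (cmod \<alpha>)\<close>. Inserting the nonnegative term
  \<open>ln (1 + x)\<close> loses a factor 2, harmless where only some positive constant is
  wanted.\<close>

lemma artanh_ge_half:
  assumes "0 \<le> x" "x < (1::real)"
  shows "x / 2 \<le> artanh x"
proof -
  have "x \<le> - ln (1 - x)"
    using ln_add_one_self_le_self2[of "- x"] assms by simp
  also have "\<dots> \<le> ln (1 + x) - ln (1 - x)"
    using assms by simp
  also have "\<dots> = 2 * artanh x"
    using assms by (simp add: artanh_def ln_div)
  finally show ?thesis by simp
qed

lemma kobayashi_pseudodistance: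
  assumes "domain D" shows "pseudodistance_on D (kobayashi D)"
  using kobayashi_greatest(1)[OF assms] by (simp add: pseudodistances_below_lempert_def)

lemma kobayashi_refl: "domain D \<Longrightarrow> z \<in> D \<Longrightarrow> kobayashi D z z = 0"
  using kobayashi_pseudodistance unfolding pseudodistance_on_def by blast

lemma kobayashi_sym: "domain D \<Longrightarrow> z \<in> D \<Longrightarrow> w \<in> D \<Longrightarrow> kobayashi D z w = kobayashi D w z"
  using kobayashi_pseudodistance unfolding pseudodistance_on_def by blast

lemma kobayashi_nonneg: "domain D \<Longrightarrow> z \<in> D \<Longrightarrow> w \<in> D \<Longrightarrow> 0 \<le> kobayashi D z w"
  using kobayashi_pseudodistance unfolding pseudodistance_on_def by blast

lemma kobayashi_triangle:
  "domain D \<Longrightarrow> x \<in> D \<Longrightarrow> y \<in> D \<Longrightarrow> z \<in> D \<Longrightarrow> kobayashi D x z \<le> kobayashi D x y + kobayashi D y z"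
  using kobayashi_pseudodistance unfolding pseudodistance_on_def by blast

lemma analytic_disc_in: "analytic_disc D \<phi> \<Longrightarrow> cmod \<zeta> < 1 \<Longrightarrow> \<phi> \<zeta> \<in> D"
  by (auto simp: analytic_disc_def)

lemma kobayashi_disc_le:
  assumes D: "domain D" and \<phi>: "analytic_disc D \<phi>" and \<alpha>: "cmod \<alpha> < 1"
  shows "kobayashi D (\<phi> 0) (\<phi> \<alpha>) \<le> artanh (cmod \<alpha>)"
proof -
  have "ereal (kobayashi D (\<phi> 0) (\<phi> \<alpha>)) \<le> lempert D (\<phi> 0) (\<phi> \<alpha>)"
    using kobayashi_greatest(1)[OF D] analytic_disc_in[OF \<phi>, of 0] analytic_disc_in[OF \<phi> \<alpha>]
    by (auto simp: pseudodistances_below_lempert_def)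
  also have "\<dots> \<le> ereal (artanh (cmod \<alpha>))"
    unfolding lempert_def using \<phi> \<alpha> by (intro Inf_lower) auto
  finally show ?thesis by simp
qed

text \<open>Precomposition with the automorphism of the unit disc that sends 0 to
  \<open>\<beta>\<close> recentres the disc at \<open>\<phi> \<beta>\<close>; the parameter of
  \<open>\<phi> \<alpha>\<close> becomes \<open>Moebius_function 0 \<beta> \<alpha>\<close>.\<close>

lemma kobayashi_disc_le_Moebius:
  assumes D: "domain D" and \<phi>: "analytic_disc D \<phi>" and \<alpha>: "cmod \<alpha> < 1" and \<beta>: "cmod \<beta> < 1"
  shows "kobayashi D (\<phi> \<beta>) (\<phi> \<alpha>) \<le> artanh (cmod (Moebius_function 0 \<beta> \<alpha>))"
proof -
  let ?M = "Moebius_function 0 (- \<beta>)"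
  have maps: "?M ` ball 0 1 \<subseteq> ball 0 1"
    using Moebius_function_norm_lt_1[of "- \<beta>"] \<beta> by auto
  have "(\<phi> \<circ> ?M) ` ball 0 1 \<subseteq> D"
    using maps \<phi> unfolding analytic_disc_def by fastforce
  moreover have "(\<lambda>\<zeta>. (\<phi> \<circ> ?M) \<zeta> $ i) holomorphic_on ball 0 1" for i
  proof -
    have "((\<lambda>\<zeta>. \<phi> \<zeta> $ i) \<circ> ?M) holomorphic_on ball 0 1"
      using \<phi> \<beta> maps
      by (intro holomorphic_on_compose_gen[of _ _ _ "ball 0 1"])
         (auto simp: analytic_disc_def intro: Moebius_function_holomorphic)
    then show ?thesis by (simp add: o_def)
  qed
  ultimately have "analytic_disc D (\<phi> \<circ> ?M)"
    by (auto simp: analytic_disc_def)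
  moreover have "?M (Moebius_function 0 \<beta> \<alpha>) = \<alpha>"
    by (rule Moebius_function_compose) (use \<alpha> \<beta> in auto)
  moreover have "?M 0 = \<beta>"
    by (simp add: Moebius_function_of_zero)
  ultimately show ?thesis
    using kobayashi_disc_le[OF D, of "\<phi> \<circ> ?M" "Moebius_function 0 \<beta> \<alpha>"]
      Moebius_function_norm_lt_1[OF \<beta> \<alpha>, of 0] by simp
qed

text \<open>The bound vanishes as \<open>w\<close> approaches \<open>a\<close>, which makes the
  Kobayashi distance continuous for the Euclidean topology.\<close>

lemma kobayashi_le_artanh:
  assumes D: "domain D" and r: "ball a r \<subseteq> D" and w: "w \<in> ball a r"
  shows "kobayashi D a w \<le> artanh (dist a w / r)"
proof (cases "w = a")
  case True
  have "a \<in> D" using r w by (auto simp: True)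
  then show ?thesis using D by (simp add: True kobayashi_refl)
next
  case False
  \<comment> \<open>The affine disc in the direction of \<open>w - a\<close>, scaled to radius
    \<open>r\<close>, so that it stays in the ball and reaches \<open>w\<close> at parameter
    \<open>dist a w / r\<close>.\<close>
  define \<phi> where "\<phi> = (\<lambda>\<zeta>. a + (of_real (r / dist a w) * \<zeta>) *s (w - a))"
  have r0: "0 < r" and d: "dist a w < r" "0 < dist a w"
    using w False le_less_trans[OF zero_le_dist] by auto
  have "\<phi> \<zeta> \<in> D" if "\<zeta> \<in> ball 0 1" for \<zeta>
  proof -
    have "norm ((of_real (r / dist a w) * \<zeta>) *s (w - a)) = cmod \<zeta> * r"
      using d by (simp add: norm_vector_scalar_mult norm_mult norm_divide dist_norm norm_minus_commute[of a w] abs_of_pos[OF r0]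
        del: vector_sub_rdistrib vector_ssub_ldistrib of_real_divide)
    also have "\<dots> < 1 * r"
      using that r0 by (intro mult_strict_right_mono) auto
    finally have "\<phi> \<zeta> \<in> ball a r"
      by (simp add: \<phi>_def dist_norm del: vector_sub_rdistrib vector_ssub_ldistrib)
    with r show ?thesis by blast
  qed
  then have "analytic_disc D \<phi>"
    by (auto simp: analytic_disc_def \<phi>_def intro!: holomorphic_intros)
  moreover have "\<phi> 0 = a" "\<phi> (of_real (dist a w / r)) = w"
    using d less_imp_neq[OF r0] by (simp_all add: \<phi>_def vec_eq_iff)
  ultimately show ?thesis
    using kobayashi_disc_le[OF D, of \<phi> "of_real (dist a w / r)"] r0 d
    by (simp flip: of_real_divide)
qed

lemma continuous_on_kobayashi:
  assumes D: "domain D" and o: "o' \<in> D"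
  shows "continuous_on D (kobayashi D o')"
  unfolding continuous_on_eq_continuous_within
proof
  fix a assume a: "a \<in> D"
  obtain r where r: "0 < r" "ball a r \<subseteq> D"
    using D a openE[of D a] unfolding domain_def by metis
  have lim: "((\<lambda>w. artanh (dist a w / r)) \<longlongrightarrow> 0) (at a within D)"
    using r by (auto intro!: tendsto_eq_intros)
  have "\<forall>\<^sub>F w in at a within D. w \<in> ball a r \<and> w \<in> D"
    using r by (auto simp: eventually_at dist_commute intro!: exI[of _ r])
  then have "\<forall>\<^sub>F w in at a within D. norm (kobayashi D o' w - kobayashi D o' a) \<le> artanh (dist a w / r)"
  proof eventually_elim
    case (elim w)
    have "\<bar>kobayashi D o' w - kobayashi D o' a\<bar> \<le> kobayashi D a w"
      using kobayashi_triangle[OF D o a, of w] kobayashi_triangle[OF D o _ a, of w]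
        kobayashi_sym[OF D a, of w] elim by auto
    then show ?case
      using kobayashi_le_artanh[OF D r(2), of w] elim by simp
  qed
  then have "((\<lambda>w. kobayashi D o' w - kobayashi D o' a) \<longlongrightarrow> 0) (at a within D)"
    by (rule Lim_null_comparison) (fact lim)
  then show "continuous (at a within D) (kobayashi D o')"
    unfolding continuous_within by (rule LIM_zero_cancel)
qed

text \<open>The Schwarz lemma for \<open>f - f 0\<close>, whose modulus is at most
  \<open>2 * R\<close>. The extra 1 in the divisor gives the strict bound below 1 and covers
  \<open>R = 0\<close>.\<close>

lemma Schwarz_bounded_disc:
  assumes hol: "f holomorphic_on ball 0 1" and R: "\<And>\<zeta>. cmod \<zeta> < 1 \<Longrightarrow> cmod (f \<zeta>) \<le> R"
    and \<alpha>: "cmod \<alpha> < 1"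
  shows "cmod (f \<alpha> - f 0) \<le> (2 * R + 1) * cmod \<alpha>"
proof -
  have R0: "0 \<le> R" using R[of 0] norm_ge_zero[of "f 0"] by (simp del: norm_ge_zero)
  let ?h = "\<lambda>\<zeta>. (f \<zeta> - f 0) / of_real (2 * R + 1)"
  have R1: "cmod (of_real (2 * R + 1)) = 2 * R + 1" using R0 by (simp only: norm_of_real)
  have "cmod (?h \<alpha>) \<le> cmod \<alpha>"
  proof (rule Schwarz_Lemma(1))
    show "?h holomorphic_on ball 0 1"
      using hol R0 R1 by (intro holomorphic_intros) auto
    show "cmod (?h z) < 1" if "cmod z < 1" for z
    proof -
      have "cmod (f z - f 0) \<le> R + R"
        using R[OF that] R[of 0] by (intro order_trans[OF norm_triangle_ineq4] add_mono) auto
      then show ?thesis using R0 by (simp add: norm_divide R1 del: of_real_add)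
    qed
  qed (use \<alpha> in auto)
  then show ?thesis using R0 by (simp add: norm_divide R1 field_simps del: of_real_add)
qed

text \<open>A small multiple of the Euclidean distance is itself a pseudodistance below the Lempert
  function, by the Schwarz lemma in each component; maximality of the Kobayashi distance does the
  rest.\<close>

lemma kobayashi_lower_bound:
  fixes D :: "(complex ^ 'n) set"
  assumes D: "domain D" and "bounded D"
  obtains c where "0 < c" "\<And>z w. z \<in> D \<Longrightarrow> w \<in> D \<Longrightarrow> c * dist z w \<le> kobayashi D z w"
proof -
  obtain R where R: "0 < R" "\<And>z. z \<in> D \<Longrightarrow> norm z \<le> R"
    using \<open>bounded D\<close> by (auto simp: bounded_pos)
  \<comment> \<open>\<open>2 * R + 1\<close> is the Schwarz constant of one component, and the norm
    is bounded by the sum over all components. The further 2 in \<open>d\<close> pays for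
    \<open>artanh_ge_half\<close>.\<close>
  define N where "N = real CARD('n) * (2 * R + 1)"
  have N: "0 < N" using R by (simp add: N_def)
  define d where "d = (\<lambda>z w :: complex ^ 'n. dist z w / (2 * N))"
  have below: "ereal (d z w) \<le> lempert D z w" for z w
    unfolding lempert_def
  proof (rule Inf_greatest, clarify)
    fix \<alpha> :: complex and \<phi> :: "complex \<Rightarrow> complex ^ 'n"
    assume \<alpha>: "\<alpha> \<in> ball 0 1" and \<phi>: "analytic_disc D \<phi>"
    have "norm (\<phi> \<alpha> - \<phi> 0) \<le> (\<Sum>i\<in>UNIV. cmod (\<phi> \<alpha> $ i - \<phi> 0 $ i))"
      by (simp add: norm_vec_def L2_set_le_sum)
    also have "\<dots> \<le> (\<Sum>i\<in>(UNIV::'n set). (2 * R + 1) * cmod \<alpha>)"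
    proof (rule sum_mono)
      fix i
      have "cmod (\<phi> \<zeta> $ i) \<le> R" if "cmod \<zeta> < 1" for \<zeta>
        using Finite_Cartesian_Product.norm_nth_le[of "\<phi> \<zeta>" i] R(2)[OF analytic_disc_in[OF \<phi> that]] by simp
      then show "cmod (\<phi> \<alpha> $ i - \<phi> 0 $ i) \<le> (2 * R + 1) * cmod \<alpha>"
        using Schwarz_bounded_disc[of "\<lambda>\<zeta>. \<phi> \<zeta> $ i" R \<alpha>] \<phi> \<alpha> by (auto simp: analytic_disc_def)
    qed
    also have "\<dots> = N * cmod \<alpha>" by (simp add: N_def)
    also have "\<dots> \<le> N * (2 * artanh (cmod \<alpha>))"
      using artanh_ge_half[of "cmod \<alpha>"] \<alpha> N by (intro mult_left_mono) auto
    finally show "ereal (d (\<phi> 0) (\<phi> \<alpha>)) \<le> ereal (artanh (cmod \<alpha>))"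
      using N by (simp add: d_def dist_norm norm_minus_commute field_simps)
  qed
  have "pseudodistance_on D d"
    using N by (auto simp: pseudodistance_on_def d_def dist_commute dist_triangle
      simp flip: add_divide_distrib intro!: divide_right_mono)
  with below have "d \<in> pseudodistances_below_lempert D"
    by (simp add: pseudodistances_below_lempert_def)
  from kobayashi_greatest(2)[OF D this] N show ?thesis
    by (intro that[of "1 / (2 * N)"]) (auto simp: d_def)
qed

subsection \<open>Approximate intermediate points\<close>

text \<open>The subtraction formula for tanh: the Poincare distance is additive along a
  radius.\<close>

lemma artanh_diff_real:
  assumes "0 \<le> b" "b \<le> a" "a < (1::real)"
  shows "artanh ((a - b) / (1 - b * a)) = artanh a - artanh b"
proof -
  define s t where "s = artanh a" and "t = artanh b"
  have ab: "a = tanh s" "b = tanh t"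
    using assms by (simp_all add: s_def t_def tanh_artanh_real)
  have "(a - b) / (1 - b * a) = tanh (s - t)"
    using tanh_add[of s "- t"] by (simp add: ab mult.commute)
  then show ?thesis
    by (simp add: artanh_tanh_real s_def t_def)
qed

text \<open>A substitute for joining \<open>z\<close> and \<open>w\<close> by a path of length
  \<open>r\<close>: every division of the budget \<open>r\<close> is realised by a point. This form
  survives concatenation and delivers intermediate points without any curves.\<close>

definition splits :: "(complex ^ 'n) set \<Rightarrow> complex ^ 'n \<Rightarrow> complex ^ 'n \<Rightarrow> real \<Rightarrow> bool" where
  "splits D z w r \<longleftrightarrow> 0 \<le> r \<and>
     (\<forall>t. 0 \<le> t \<and> t \<le> r \<longrightarrow> (\<exists>u\<in>D. kobayashi D z u \<le> t \<and> kobayashi D u w \<le> r - t))"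

lemma splitsI:
  assumes "0 \<le> r"
    and "\<And>t. 0 \<le> t \<Longrightarrow> t \<le> r \<Longrightarrow> \<exists>u\<in>D. kobayashi D z u \<le> t \<and> kobayashi D u w \<le> r - t"
  shows "splits D z w r"
  using assms by (simp add: splits_def)

lemma splitsD:
  assumes "splits D z w r" "0 \<le> t" "t \<le> r"
  obtains u where "u \<in> D" "kobayashi D z u \<le> t" "kobayashi D u w \<le> r - t"
  using assms unfolding splits_def by blast

lemma splits_imp_le:
  assumes D: "domain D" and zw: "z \<in> D" "w \<in> D" and s: "splits D z w r"
  shows "kobayashi D z w \<le> r"
proof -
  have "0 \<le> r" using s by (simp add: splits_def)
  then obtain u where "u \<in> D" "kobayashi D z u \<le> 0" "kobayashi D u w \<le> r - 0"
    using splitsD[OF s, of 0] by auto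
  with kobayashi_triangle[OF D zw(1) \<open>u \<in> D\<close> zw(2)] show ?thesis by linarith
qed

text \<open>With twice the distance as budget an endpoint can serve as the dividing point:
  \<open>z\<close> for small \<open>t\<close>, \<open>w\<close> for large \<open>t\<close>. This
  shows that some budget always works.\<close>

lemma splits_trivial:
  assumes D: "domain D" and zw: "z \<in> D" "w \<in> D"
  shows "splits D z w (2 * kobayashi D z w)"
proof (rule splitsI)
  fix t assume "0 \<le> t" "t \<le> 2 * kobayashi D z w"
  then show "\<exists>u\<in>D. kobayashi D z u \<le> t \<and> kobayashi D u w \<le> 2 * kobayashi D z w - t"
    using kobayashi_refl[OF D] zw by (cases "t \<le> kobayashi D z w") (force intro: bexI[of _ z] bexI[of _ w])+
qed (use kobayashi_nonneg[OF D zw] in simp)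

lemma splits_refl: "domain D \<Longrightarrow> z \<in> D \<Longrightarrow> splits D z z 0"
  using splits_trivial[of D z z] by (simp add: kobayashi_refl)

lemma splits_sym:
  assumes D: "domain D" and zw: "z \<in> D" "w \<in> D" and s: "splits D z w r"
  shows "splits D w z r"
proof (rule splitsI)
  show "0 \<le> r" using s by (simp add: splits_def)
  fix t assume "0 \<le> t" "t \<le> r"
  then obtain u where "u \<in> D" "kobayashi D z u \<le> r - t" "kobayashi D u w \<le> r - (r - t)"
    using splitsD[OF s, of "r - t"] by auto
  then show "\<exists>u\<in>D. kobayashi D w u \<le> t \<and> kobayashi D u z \<le> r - t"
    using kobayashi_sym[OF D] zw by (intro bexI[of _ u]) auto
qed

text \<open>A cut at \<open>t \<le> r\<close> is made in the first leg, a later one in the second;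
  the leg left uncut is bounded by \<open>splits_imp_le\<close>.\<close>

lemma splits_trans:
  assumes D: "domain D" and mem: "x \<in> D" "y \<in> D" "z \<in> D"
    and r: "splits D x y r" and s: "splits D y z s"
  shows "splits D x z (r + s)"
proof (rule splitsI)
  have rs: "0 \<le> r" "0 \<le> s" using r s by (simp_all add: splits_def)
  then show "0 \<le> r + s" by simp
  fix t assume t: "0 \<le> t" "t \<le> r + s"
  show "\<exists>u\<in>D. kobayashi D x u \<le> t \<and> kobayashi D u z \<le> r + s - t"
  proof (cases "t \<le> r")
    case True
    with t obtain u where "u \<in> D" "kobayashi D x u \<le> t" "kobayashi D u y \<le> r - t"
      using splitsD[OF r] by blast
    then show ?thesis
      using kobayashi_triangle[OF D \<open>u \<in> D\<close> mem(2,3)] splits_imp_le[OF D mem(2,3) s]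
      by (intro bexI[of _ u]) auto
  next
    case False
    with t obtain u where "u \<in> D" "kobayashi D y u \<le> t - r" "kobayashi D u z \<le> s - (t - r)"
      using splitsD[OF s, of "t - r"] by auto
    then show ?thesis
      using kobayashi_triangle[OF D mem(1,2) \<open>u \<in> D\<close>] splits_imp_le[OF D mem(1,2) r]
      by (intro bexI[of _ u]) auto
  qed
qed

text \<open>The dividing points are the images of the points on the radius from 0 to
  \<open>\<alpha>\<close>, along which the Poincare distance is additive.\<close>

lemma splits_disc:
  assumes D: "domain D" and \<phi>: "analytic_disc D \<phi>" and \<alpha>: "cmod \<alpha> < 1"
  shows "splits D (\<phi> 0) (\<phi> \<alpha>) (artanh (cmod \<alpha>))"
proof (cases "\<alpha> = 0")
  case True
  then show ?thesis using splits_refl[OF D analytic_disc_in[OF \<phi> \<alpha>]] by simp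
next
  case False
  show ?thesis
  proof (rule splitsI)
    show "0 \<le> artanh (cmod \<alpha>)"
      using artanh_ge_half[of "cmod \<alpha>"] \<alpha> norm_ge_zero[of \<alpha>] by linarith
    fix t assume t: "0 \<le> t" "t \<le> artanh (cmod \<alpha>)"
    define a b where "a = cmod \<alpha>" and "b = tanh t"
    have a: "0 < a" "a < 1" using \<alpha> False by (simp_all add: a_def)
    have "b \<le> tanh (artanh a)" using t(2) by (simp add: b_def a_def)
    then have b: "0 \<le> b" "b \<le> a" "b < 1"
      using t a by (simp_all add: b_def tanh_artanh_real tanh_real_lt_1)
    \<comment> \<open>The point at Poincare distance \<open>t\<close> from 0 on the radius to
      \<open>\<alpha>\<close>. Lying on that radius makes \<open>cnj \<beta> * \<alpha>\<close>
      real, so the modulus of the Moebius function becomes a real quotient.\<close>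
    define \<beta> where "\<beta> = of_real (b / a) * \<alpha>"
    have \<beta>: "cmod \<beta> = b"
      using a b by (simp add: \<beta>_def norm_mult norm_divide flip: a_def)
    have "cnj \<alpha> * \<alpha> = of_real (a\<^sup>2)"
      using complex_norm_square[of \<alpha>] by (simp add: a_def mult.commute)
    then have "cnj \<beta> * \<alpha> = of_real (b * a)"
      using a by (simp add: \<beta>_def power2_eq_square mult.assoc)
    moreover have "\<alpha> - \<beta> = of_real (1 - b / a) * \<alpha>"
      by (simp add: \<beta>_def algebra_simps)
    ultimately have "Moebius_function 0 \<beta> \<alpha> = of_real (1 - b / a) * \<alpha> / of_real (1 - b * a)"
      by (simp add: Moebius_function_simple)
    then have "cmod (Moebius_function 0 \<beta> \<alpha>) = \<bar>1 - b / a\<bar> * a / \<bar>1 - b * a\<bar>"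
      by (simp only: norm_mult norm_divide norm_of_real a_def)
    also have "\<dots> = (a - b) / (1 - b * a)"
    proof -
      have "b * a < 1" using mult_strict_mono'[of b 1 a 1] a b by simp
      moreover have "b / a \<le> 1" using a b by simp
      ultimately show ?thesis using a by (simp add: field_simps)
    qed
    finally have "artanh (cmod (Moebius_function 0 \<beta> \<alpha>)) = artanh a - t"
      using artanh_diff_real[OF b(1,2) a(2)] by (simp add: b_def artanh_tanh_real)
    then have "kobayashi D (\<phi> \<beta>) (\<phi> \<alpha>) \<le> artanh (cmod \<alpha>) - t"
      using kobayashi_disc_le_Moebius[OF D \<phi> \<alpha>, of \<beta>] b \<beta> by (simp add: a_def)
    moreover have "kobayashi D (\<phi> 0) (\<phi> \<beta>) \<le> t"
      using kobayashi_disc_le[OF D \<phi>, of \<beta>] b \<beta> by (simp add: b_def artanh_tanh_real)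
    moreover have "\<phi> \<beta> \<in> D"
      using analytic_disc_in[OF \<phi>] b \<beta> by simp
    ultimately show "\<exists>u\<in>D. kobayashi D (\<phi> 0) u \<le> t \<and> kobayashi D u (\<phi> \<alpha>) \<le> artanh (cmod \<alpha>) - t"
      by blast
  qed
qed

text \<open>
  The least \<open>r\<close> for which \<open>splits D z w r\<close> holds is again a pseudodistance below the Lempert
  function, so by maximality it does not exceed the Kobayashi distance.
\<close>

lemma kobayashi_splits:
  assumes D: "domain D" and zw: "z \<in> D" "w \<in> D" and \<epsilon>: "0 < \<epsilon>"
  obtains r where "r < kobayashi D z w + \<epsilon>" "splits D z w r"
proof -
  define d where "d = (\<lambda>z w. Inf {r. splits D z w r})"
  have bdd: "bdd_below {r. splits D z w r}" for z w
    by (rule bdd_belowI[of _ 0]) (simp add: splits_def)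
  have ne: "{r. splits D z w r} \<noteq> {}" if "z \<in> D" "w \<in> D" for z w
    using splits_trivial[OF D that] by blast
  have le: "d z w \<le> r" if "splits D z w r" for z w r
    unfolding d_def using that bdd by (auto intro: cInf_lower)
  have near: "\<exists>r. splits D z w r \<and> r < d z w + \<epsilon>" if "z \<in> D" "w \<in> D" "0 < \<epsilon>" for z w \<epsilon>
    using cInf_lessD[OF ne[OF that(1,2)], of "d z w + \<epsilon>"] that(3) by (auto simp: d_def)
  have nonneg: "0 \<le> d z w" if "z \<in> D" "w \<in> D" for z w
    unfolding d_def using ne[OF that] by (rule cInf_greatest) (simp add: splits_def)
  have "d z w = d w z" if "z \<in> D" "w \<in> D" for z w
    using splits_sym[OF D that] splits_sym[OF D that(2,1)]
    unfolding d_def by (intro arg_cong[where f = Inf]) blast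
  moreover have "d z z = 0" if "z \<in> D" for z
    using le[OF splits_refl[OF D that]] nonneg[OF that that] by simp
  moreover have "d x z \<le> d x y + d y z" if xyz: "x \<in> D" "y \<in> D" "z \<in> D" for x y z
  proof (rule field_le_epsilon)
    fix e :: real assume "0 < e"
    then obtain r s where "splits D x y r" "r < d x y + e / 2" "splits D y z s" "s < d y z + e / 2"
      using near[OF xyz(1,2), of "e / 2"] near[OF xyz(2,3), of "e / 2"] by auto
    then show "d x z \<le> d x y + d y z + e"
      using le[OF splits_trans[OF D xyz, of r s]] by simp
  qed
  ultimately have "pseudodistance_on D d"
    using nonneg unfolding pseudodistance_on_def by blast
  moreover have "ereal (d z w) \<le> lempert D z w" if "z \<in> D" "w \<in> D" for z w
    unfolding lempert_def using le[OF splits_disc[OF D]] by (intro Inf_greatest) auto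
  ultimately have "d z w \<le> kobayashi D z w"
    using kobayashi_greatest(2)[OF D, of d] zw by (simp add: pseudodistances_below_lempert_def)
  moreover obtain r where "splits D z w r" "r < d z w + \<epsilon>"
    using near[OF zw \<epsilon>] by blast
  ultimately show ?thesis
    by (intro that[of r]) simp_all
qed

subsection \<open>Strong completeness and geodesics\<close>

lemma strongly_completeD:
  assumes "strongly_complete G"
  shows "domain G" "bounded G"
  using assms by (auto simp: strongly_complete_def bounded_complete_domain_def)

lemma visibleD:
  assumes "visible D"
  shows "domain D" "bounded D"
  using assms by (auto simp: visible_def bounded_complete_domain_def)

lemma domain_frontier:
  assumes "domain D"
  shows "frontier D = closure D - D"
  using assms by (simp add: domain_def frontier_def interior_open)

text \<open>Strong completeness applied to constant geodesics already yields properness.\<close>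

lemma kobayashi_at_top_at_frontier:
  assumes G: "strongly_complete G" and o: "o' \<in> G" and p: "p \<in> frontier G"
    and z: "\<And>j::nat. z j \<in> G" "z \<longlonglongrightarrow> p"
  shows "filterlim (\<lambda>j. kobayashi G o' (z j)) at_top sequentially"
proof -
  note dom = strongly_completeD(1)[OF G]
  have "real_geodesic G 0 0 (\<lambda>_. z j)" for j
    using z kobayashi_refl[OF dom] by (auto simp: real_geodesic_def)
  then obtain q where q: "q \<in> G"
    "filterlim (\<lambda>j. INF u \<in> (\<lambda>_. z j) ` {0..0::real}. kobayashi G q u) at_top sequentially"
    using G p z(2) unfolding strongly_complete_def by meson
  \<comment> \<open>The definition gives divergence from some base point \<open>q\<close>;
    subtracting the constant \<open>kobayashi G q o'\<close> moves it to \<open>o'\<close>.\<close>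
  then have "filterlim (\<lambda>j. - kobayashi G q o' + kobayashi G q (z j)) at_top sequentially"
    by (intro filterlim_tendsto_add_at_top[OF tendsto_const]) simp_all
  then show ?thesis
    by (rule filterlim_at_top_mono)
       (use kobayashi_triangle[OF dom q(1) o z(1)] in \<open>simp add: algebra_simps\<close>)
qed

text \<open>A sequence in the ball has a Euclidean limit in the closure of \<open>G\<close>. A limit
  on the frontier would force the distances to infinity, and at a limit in \<open>G\<close>
  continuity preserves the bound.\<close>

lemma compact_kobayashi_cball:
  assumes G: "strongly_complete G" and o: "o' \<in> G"
  shows "compact {u \<in> G. kobayashi G o' u \<le> r}"
  unfolding compact_def
proof (intro allI impI)
  note dom = strongly_completeD(1)[OF G]
  fix f :: "nat \<Rightarrow> _" assume f: "\<forall>n. f n \<in> {u \<in> G. kobayashi G o' u \<le> r}"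
  have "compact (closure G)" using strongly_completeD(2)[OF G] by simp
  moreover have "\<forall>n. f n \<in> closure G" using f closure_subset by blast
  ultimately obtain l \<sigma> where l: "l \<in> closure G" "strict_mono \<sigma>" "(f \<circ> \<sigma>) \<longlonglongrightarrow> l"
    unfolding compact_def by metis
  have in_G: "(f \<circ> \<sigma>) j \<in> G" for j using f by simp
  have "l \<in> G"
  proof (rule ccontr)
    assume "l \<notin> G"
    then have "filterlim (\<lambda>j. kobayashi G o' ((f \<circ> \<sigma>) j)) at_top sequentially"
      using l domain_frontier[OF dom] by (intro kobayashi_at_top_at_frontier[OF G o _ in_G l(3)]) auto
    then have "\<forall>\<^sub>F j in sequentially. r < kobayashi G o' ((f \<circ> \<sigma>) j)"
      by (simp add: filterlim_at_top_dense)
    then obtain j where "r < kobayashi G o' ((f \<circ> \<sigma>) j)"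
      using eventually_happens'[OF sequentially_bot] by blast
    with f show False by (simp add: not_le[symmetric])
  qed
  then have "(\<lambda>j. kobayashi G o' ((f \<circ> \<sigma>) j)) \<longlonglongrightarrow> kobayashi G o' l"
    using continuous_on_tendsto_compose[OF continuous_on_kobayashi[OF dom o] l(3)] in_G by simp
  then have "kobayashi G o' l \<le> r"
    by (rule LIMSEQ_le_const2) (use f in auto)
  with \<open>l \<in> G\<close> l(2,3)
  show "\<exists>l\<in>{u \<in> G. kobayashi G o' u \<le> r}. \<exists>\<sigma>. strict_mono \<sigma> \<and> (f \<circ> \<sigma>) \<longlonglongrightarrow> l"
    by blast
qed

text \<open>\<open>kobayashi_splits\<close> gives such points only up to an error. They all compete
  in minimising the distance to \<open>w\<close> over the compact ball of radius \<open>t\<close>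
  about \<open>z\<close>, so the minimiser is exact.\<close>

lemma kobayashi_intermediate_point:
  assumes G: "strongly_complete G" and zw: "z \<in> G" "w \<in> G"
    and t: "0 \<le> t" "t \<le> kobayashi G z w"
  obtains u where "u \<in> G" "kobayashi G z u \<le> t" "kobayashi G u w \<le> kobayashi G z w - t"
proof -
  note dom = strongly_completeD(1)[OF G]
  let ?S = "{u \<in> G. kobayashi G z u \<le> t}"
  have "z \<in> ?S" using zw t kobayashi_refl[OF dom] by simp
  moreover have "continuous_on ?S (kobayashi G w)"
    using continuous_on_subset[OF continuous_on_kobayashi[OF dom zw(2)]] by auto
  ultimately obtain u where u: "u \<in> ?S" "\<And>v. v \<in> ?S \<Longrightarrow> kobayashi G w u \<le> kobayashi G w v"
    using continuous_attains_inf[OF compact_kobayashi_cball[OF G zw(1), of t]] by blast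
  have "kobayashi G u w \<le> kobayashi G z w - t"
  proof (rule field_le_epsilon)
    fix e :: real assume "0 < e"
    from kobayashi_splits[OF dom zw this] obtain r
      where r: "r < kobayashi G z w + e" "splits G z w r" by blast
    have "t \<le> r" using splits_imp_le[OF dom zw r(2)] t by simp
    with splitsD[OF r(2) t(1)] obtain v
      where v: "v \<in> G" "kobayashi G z v \<le> t" "kobayashi G v w \<le> r - t" by blast
    then show "kobayashi G u w \<le> kobayashi G z w - t + e"
      using u(2)[of v] u(1) r(1) kobayashi_sym[OF dom zw(2)] by fastforce
  qed
  with u(1) that show ?thesis by blast
qed

text \<open>
  A geodesic is obtained as a maximal isometric relation between parameters and points: compactness
  of balls gives the finite intersection property needed to add a missing parameter.
\<close>

lemma real_geodesic_exists:
  fixes G :: "(complex ^ 'm) set"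
  assumes G: "strongly_complete G" and zw: "z \<in> G" "w \<in> G"
  obtains \<psi> where "real_geodesic G 0 (kobayashi G z w) \<psi>" "\<psi> 0 = z" "\<psi> (kobayashi G z w) = w"
proof -
  note dom = strongly_completeD(1)[OF G]
  define L where "L = kobayashi G z w"
  have L: "0 \<le> L" using kobayashi_nonneg[OF dom zw] by (simp add: L_def)
  \<comment> \<open>Members need not be single-valued by definition: at equal parameters the last
    condition only says that the distance is 0. Uniqueness follows later from the Euclidean lower
    bound.\<close>
  define A :: "(real \<times> (complex ^ 'm)) set set" where
    "A = {R. (0, z) \<in> R \<and> (L, w) \<in> R \<and> R \<subseteq> {0..L} \<times> G \<and>
             (\<forall>s x t y. (s, x) \<in> R \<longrightarrow> (t, y) \<in> R \<longrightarrow> kobayashi G x y = \<bar>s - t\<bar>)}"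
  have "{(0, z), (L, w)} \<in> A"
    using zw L kobayashi_refl[OF dom] kobayashi_sym[OF dom zw] by (auto simp: A_def L_def)
  then have "A \<noteq> {}" by blast
  moreover have "\<Union>\<C> \<in> A" if ne: "\<C> \<noteq> {}" and ch: "subset.chain A \<C>" for \<C>
  proof -
    have sub: "\<And>R. R \<in> \<C> \<Longrightarrow> R \<in> A" using ch by (auto simp: subset_chain_def)
    have "kobayashi G x y = \<bar>s - t\<bar>" if xy: "(s, x) \<in> \<Union>\<C>" "(t, y) \<in> \<Union>\<C>" for s x t y
    proof -
      from xy obtain R1 R2 where R: "R1 \<in> \<C>" "R2 \<in> \<C>" "(s, x) \<in> R1" "(t, y) \<in> R2" by blast
      then have "R1 \<subseteq> R2 \<or> R2 \<subseteq> R1" using ch by (auto simp: subset_chain_def)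
      with R obtain R where "R \<in> \<C>" "(s, x) \<in> R" "(t, y) \<in> R" by blast
      with sub[of R] show ?thesis by (auto simp: A_def)
    qed
    with ne sub show ?thesis unfolding A_def by blast
  qed
  ultimately have "\<exists>M\<in>A. \<forall>X\<in>A. M \<subseteq> X \<longrightarrow> X = M"
    by (rule subset_Zorn_nonempty)
  then obtain M where M: "M \<in> A" and max: "\<And>X. X \<in> A \<Longrightarrow> M \<subseteq> X \<Longrightarrow> X = M" by blast
  have endpoints: "(0, z) \<in> M" "(L, w) \<in> M"
    and mem: "\<And>s x. (s, x) \<in> M \<Longrightarrow> 0 \<le> s \<and> s \<le> L \<and> x \<in> G"
    and iso: "\<And>s x t y. (s, x) \<in> M \<Longrightarrow> (t, y) \<in> M \<Longrightarrow> kobayashi G x y = \<bar>s - t\<bar>"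
    using M by (auto simp: A_def)
  have "\<exists>x. (t, x) \<in> M" if t: "0 \<le> t" "t \<le> L" for t
  proof -
    \<comment> \<open>\<open>S p\<close> is the ball in which a point added at parameter
      \<open>t\<close> must lie on account of \<open>p\<close>; a common point of all these balls is
      sought.\<close>
    define S where "S = (\<lambda>p :: real \<times> (complex ^ 'm). {u \<in> G. kobayashi G (snd p) u \<le> \<bar>fst p - t\<bar>})"
    have compact_S: "compact (S p)" if "p \<in> M" for p
      unfolding S_def using compact_kobayashi_cball[OF G] mem[of "fst p" "snd p"] that by simp
    have "S (0, z) \<inter> (\<Inter>p\<in>M. S p) \<noteq> {}"
    proof (rule compact_imp_fip_image)
      show "compact (S (0, z))" using compact_S endpoints by blast
      show "closed (S p)" if "p \<in> M" for p using compact_S[OF that] by (rule compact_imp_closed)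
      fix F assume F: "finite F" "F \<subseteq> M"
      \<comment> \<open>Adding both endpoints ensures that there are parameters on either side of
        \<open>t\<close>, so the nearest ones \<open>s1 \<le> t \<le> s2\<close> exist.\<close>
      define F' where "F' = insert (0, z) (insert (L, w) F)"
      have F': "finite F'" "F' \<subseteq> M" "(0, z) \<in> F'" "(L, w) \<in> F'"
        using F endpoints by (auto simp: F'_def)
      let ?lower = "{p \<in> F'. fst p \<le> t}" and ?upper = "{p \<in> F'. t \<le> fst p}"
      have fin: "finite (fst ` ?lower)" "finite (fst ` ?upper)"
        using F'(1) by simp_all
      have "fst ` ?lower \<noteq> {}" "fst ` ?upper \<noteq> {}"
        using F'(3,4) t by force+
      then have "Max (fst ` ?lower) \<in> fst ` ?lower" "Min (fst ` ?upper) \<in> fst ` ?upper"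
        using fin by (simp_all only: Max_in Min_in not_False_eq_True)
      then obtain s1 x1 s2 x2
        where s1: "s1 = Max (fst ` ?lower)" and 1: "(s1, x1) \<in> F'" "s1 \<le> t"
          and s2: "s2 = Min (fst ` ?upper)" and 2: "(s2, x2) \<in> F'" "t \<le> s2"
        by auto
      have s1_ge: "s \<le> s1" if "(s, x) \<in> F'" "s \<le> t" for s x
        unfolding s1 using that fin by (force intro: Max_ge)
      have s2_le: "s2 \<le> s" if "(s, x) \<in> F'" "t \<le> s" for s x
        unfolding s2 using that fin by (force intro: Min_le)
      have x: "x1 \<in> G" "x2 \<in> G" and in_M: "(s1, x1) \<in> M" "(s2, x2) \<in> M"
        using 1(1) 2(1) F'(2) mem by blast+
      have "kobayashi G x1 x2 = s2 - s1" using iso[OF in_M] 1(2) 2(2) by simp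
      \<comment> \<open>A point dividing \<open>x1\<close> and \<open>x2\<close> at \<open>t\<close>
        lies in the balls of all of \<open>F'\<close>, by the triangle inequality through the
        neighbour on the same side of \<open>t\<close>.\<close>
      with kobayashi_intermediate_point[OF G x, of "t - s1"] 1(2) 2(2)
      obtain u where u: "u \<in> G" "kobayashi G x1 u \<le> t - s1" "kobayashi G u x2 \<le> s2 - t"
        by auto
      have "u \<in> S (s, x)" if sx: "(s, x) \<in> F'" for s x
      proof -
        have sxM: "(s, x) \<in> M" and xG: "x \<in> G" using sx F'(2) mem by blast+
        show ?thesis
        proof (cases "s \<le> t")
          case True
          then show ?thesis
            using kobayashi_triangle[OF dom xG x(1) u(1)] iso[OF sxM in_M(1)] s1_ge[OF sx] u 1(2)
            by (simp add: S_def)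
        next
          case False
          then show ?thesis
            using kobayashi_triangle[OF dom xG x(2) u(1)] iso[OF sxM in_M(2)] s2_le[OF sx] u 2(2)
              kobayashi_sym[OF dom x(2) u(1)]
            by (simp add: S_def)
        qed
      qed
      then have "\<forall>p\<in>F'. u \<in> S p" by auto
      then show "S (0, z) \<inter> (\<Inter>p\<in>F. S p) \<noteq> {}" by (auto simp: F'_def)
    qed
    then obtain u where u: "u \<in> G" "\<And>s x. (s, x) \<in> M \<Longrightarrow> kobayashi G x u \<le> \<bar>s - t\<bar>"
      unfolding S_def by fastforce
    have dist_u: "kobayashi G x u = \<bar>s - t\<bar>" if sx: "(s, x) \<in> M" for s x
    proof (rule antisym[OF u(2)[OF sx]])
      have xG: "x \<in> G" "0 \<le> s" "s \<le> L" using mem[OF sx] by auto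
      \<comment> \<open>A smaller distance would make the route through \<open>u\<close> from
        \<open>x\<close> to \<open>w\<close> (if \<open>s \<le> t\<close>) or from \<open>z\<close>
        to \<open>x\<close> (if \<open>t \<le> s\<close>) shorter than \<open>iso\<close>
        allows.\<close>
      show "\<bar>s - t\<bar> \<le> kobayashi G x u"
        using kobayashi_triangle[OF dom xG(1) u(1) zw(2)] kobayashi_triangle[OF dom zw(1) u(1) xG(1)]
          iso[OF sx endpoints(2)] iso[OF endpoints(1) sx] u(2)[OF endpoints(1)] u(2)[OF endpoints(2)]
          kobayashi_sym[OF dom u(1) zw(2)] kobayashi_sym[OF dom u(1) xG(1)] t xG(2,3)
        by linarith
    qed
    have "kobayashi G u x = \<bar>t - s\<bar>" if "(s, x) \<in> M" for s x
      using dist_u[OF that] kobayashi_sym[OF dom u(1), of x] mem[OF that] by (simp add: abs_minus_commute)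
    moreover have "kobayashi G u u = \<bar>t - t\<bar>"
      using kobayashi_refl[OF dom u(1)] by simp
    ultimately have "kobayashi G x y = \<bar>r - s\<bar>"
      if "(r, x) \<in> insert (t, u) M" "(s, y) \<in> insert (t, u) M" for r x s y
      using that dist_u iso by (elim insertE) (simp_all only: prod.inject)
    moreover have "insert (t, u) M \<subseteq> {0..L} \<times> G"
      using M u(1) t by (simp add: A_def)
    ultimately have "insert (t, u) M \<in> A"
      unfolding A_def using endpoints by (intro CollectI conjI allI impI) simp_all
    from max[OF this] have "insert (t, u) M = M" by blast
    then show ?thesis by blast
  qed
  then obtain \<psi> where \<psi>: "\<And>t. 0 \<le> t \<Longrightarrow> t \<le> L \<Longrightarrow> (t, \<psi> t) \<in> M" by metis
  \<comment> \<open>Comparison with the Euclidean distance makes the chosen \<open>\<psi>\<close>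
    Lipschitz and forces its values at 0 and \<open>L\<close> to be \<open>z\<close> and
    \<open>w\<close>.\<close>
  obtain c where c: "0 < c" "\<And>x y. x \<in> G \<Longrightarrow> y \<in> G \<Longrightarrow> c * dist x y \<le> kobayashi G x y"
    using kobayashi_lower_bound[OF strongly_completeD[OF G]] by blast
  have dist_le: "dist x y \<le> 1 / c * \<bar>s - t\<bar>" if "(s, x) \<in> M" "(t, y) \<in> M" for s x t y
    using c(2)[of x y] c(1) mem that iso[OF that] by (simp add: field_simps)
  have ends: "\<psi> 0 = z" "\<psi> L = w"
    using dist_le[OF \<psi>[of 0] endpoints(1)] dist_le[OF \<psi>[of L] endpoints(2)] L by simp_all
  have "(1 / c)-lipschitz_on {0..L} \<psi>"
    using dist_le \<psi> c(1) by (intro lipschitz_onI) (auto simp: dist_real_def)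
  then have "continuous_on {0..L} \<psi>"
    by (rule lipschitz_on_continuous_on)
  then have "real_geodesic G 0 L \<psi>"
    using mem[OF \<psi>] iso[OF \<psi> \<psi>] L by (auto simp: real_geodesic_def)
  with ends that show ?thesis by (simp add: L_def)
qed

subsection \<open>Boundary distance and isometries\<close>

lemma boundary_dist_nonneg: "0 \<le> boundary_dist D z"
  by (simp add: boundary_dist_def infdist_nonneg)

lemma continuous_on_boundary_dist: "continuous_on S (boundary_dist D)"
  unfolding boundary_dist_def by (intro continuous_intros)

text \<open>Needed because \<open>infdist\<close> to the empty set is 0 by convention, which would
  spoil positivity of \<open>boundary_dist\<close>.\<close>

lemma frontier_nonempty:
  fixes D :: "(complex ^ 'n) set"
  assumes "domain D" "bounded D"
  shows "frontier D \<noteq> {}"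
  using assms not_bounded_UNIV by (auto simp: frontier_eq_empty domain_def)

lemma boundary_dist_pos:
  fixes D :: "(complex ^ 'n) set"
  assumes "domain D" "bounded D" "z \<in> D"
  shows "0 < boundary_dist D z"
proof -
  have "z \<notin> frontier D" using assms domain_frontier by blast
  then have "boundary_dist D z \<noteq> 0"
    using frontier_nonempty[OF assms(1,2)]
    by (simp add: boundary_dist_def in_closed_iff_infdist_zero)
  then show ?thesis using boundary_dist_nonneg[of D z] by simp
qed

text \<open>A real \<open>SUP\<close> is an upper bound only for sets bounded above. Here the bound
  comes from continuity on the compact closure of \<open>D\<close>.\<close>

lemma bdd_above_boundary_dist:
  fixes D :: "(complex ^ 'n) set"
  assumes "domain D" "bounded D" "f ` S \<subseteq> D"
  shows "bdd_above ((\<lambda>z. boundary_dist D (f z)) ` S)"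
proof -
  have "compact (closure D)" using assms(2) by simp
  then have "bounded (boundary_dist D ` closure D)"
    by (intro compact_imp_bounded compact_continuous_image continuous_on_boundary_dist)
  then have "bdd_above (boundary_dist D ` closure D)" by (rule bounded_imp_bdd_above)
  moreover have "(\<lambda>z. boundary_dist D (f z)) ` S \<subseteq> boundary_dist D ` closure D"
    using assms(3) closure_subset by fastforce
  ultimately show ?thesis by (rule bdd_above_mono)
qed

text \<open>Passing to the closure of \<open>D\<close> adds no points, since
  \<open>boundary_dist\<close> vanishes on the frontier; so the set is closed as well as
  bounded.\<close>

lemma compact_boundary_dist_ge:
  fixes D :: "(complex ^ 'n) set"
  assumes "domain D" "bounded D" "0 < \<eta>"
  shows "compact {y \<in> D. \<eta> \<le> boundary_dist D y}"
proof -
  have "closed {y \<in> closure D. \<eta> \<le> boundary_dist D y}"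
    using continuous_on_closed_Collect_le[of "closure D" "\<lambda>_. \<eta>" "boundary_dist D"]
    by (simp add: continuous_on_boundary_dist)
  moreover have "{y \<in> closure D. \<eta> \<le> boundary_dist D y} = {y \<in> D. \<eta> \<le> boundary_dist D y}"
  proof -
    have "y \<in> D" if "y \<in> closure D" "\<eta> \<le> boundary_dist D y" for y
    proof (rule ccontr)
      assume "y \<notin> D"
      with that(1) have "y \<in> frontier D" using domain_frontier[OF assms(1)] by blast
      then have "boundary_dist D y = 0" by (simp add: boundary_dist_def)
      with that(2) assms(3) show False by simp
    qed
    then show ?thesis using closure_subset by fastforce
  qed
  ultimately show ?thesis
    using assms(2) by (simp add: compact_eq_bounded_closed bounded_subset)
qed

lemma relatively_compact_inD:
  assumes "relatively_compact_in K D"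
  shows "closure K \<subseteq> D" "compact (closure K)" "K \<subseteq> D"
  using assms closure_subset[of K] by (auto simp: relatively_compact_in_def)

lemma kobayashi_bounded_on_compact:
  assumes "domain D" "a \<in> D" "compact C" "C \<subseteq> D"
  shows "\<exists>B. \<forall>x\<in>C. kobayashi D a x \<le> B"
proof -
  have "bounded (kobayashi D a ` C)"
    using assms continuous_on_kobayashi continuous_on_subset
    by (metis compact_continuous_image compact_imp_bounded)
  then show ?thesis
    unfolding bounded_iff by (metis abs_le_D1 imageI real_norm_def)
qed

lemma kobayashi_isometryD:
  assumes "kobayashi_isometry G D f" "z \<in> G"
  shows "f z \<in> D" and "w \<in> G \<Longrightarrow> kobayashi D (f z) (f w) = kobayashi G z w"
  using assms by (auto simp: kobayashi_isometry_def)

text \<open>Only continuity needs an argument, as \<open>f\<close> is not assumed continuous: the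
  Kobayashi lower bound on \<open>D\<close> makes \<open>f \<circ> \<psi>\<close> Lipschitz.\<close>

lemma kobayashi_isometry_real_geodesic:
  fixes D :: "(complex ^ 'n) set"
  assumes D: "domain D" "bounded D" and f: "kobayashi_isometry G D f"
    and \<psi>: "real_geodesic G a b \<psi>"
  shows "real_geodesic D a b (f \<circ> \<psi>)"
proof -
  have in_G: "\<psi> t \<in> G" if "t \<in> {a..b}" for t
    using \<psi> that by (auto simp: real_geodesic_def)
  have iso: "kobayashi D (f (\<psi> s)) (f (\<psi> t)) = \<bar>s - t\<bar>" if "s \<in> {a..b}" "t \<in> {a..b}" for s t
    using \<psi> that kobayashi_isometryD(2)[OF f in_G in_G] by (simp add: real_geodesic_def)
  obtain c where c: "0 < c" "\<And>x y. x \<in> D \<Longrightarrow> y \<in> D \<Longrightarrow> c * dist x y \<le> kobayashi D x y"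
    using kobayashi_lower_bound[OF D] by blast
  have "(1 / c)-lipschitz_on {a..b} (f \<circ> \<psi>)"
  proof (rule lipschitz_onI)
    fix s t assume st: "s \<in> {a..b}" "t \<in> {a..b}"
    have "c * dist (f (\<psi> s)) (f (\<psi> t)) \<le> \<bar>s - t\<bar>"
      using c(2) kobayashi_isometryD(1)[OF f in_G] st iso[OF st] by metis
    then show "dist ((f \<circ> \<psi>) s) ((f \<circ> \<psi>) t) \<le> 1 / c * dist s t"
      using c(1) by (simp add: dist_real_def field_simps)
  qed (use c in simp)
  then have "continuous_on {a..b} (f \<circ> \<psi>)"
    by (rule lipschitz_on_continuous_on)
  then show ?thesis
    using \<psi> iso kobayashi_isometryD(1)[OF f in_G] by (auto simp: real_geodesic_def)
qed

section \<open>Visibility, equicontinuity and extension to the boundary\<close>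

lemma visible_geodesic_points_escape:
  fixes D :: "(complex ^ 'n) set"
  assumes G: "strongly_complete G" and D: "visible D"
    and f: "\<And>j. kobayashi_isometry G D (f j)"
    and z: "\<And>j. z j \<in> G" "z \<longlonglongrightarrow> p" and w: "\<And>j. w j \<in> G" "w \<longlonglongrightarrow> p"
    and \<epsilon>: "0 < \<epsilon>" "\<And>j::nat. \<epsilon> \<le> dist (f j (z j)) (f j (w j))"
  obtains K u where "relatively_compact_in K D" "\<And>j. u j \<in> G" "\<And>j. f j (u j) \<in> K"
    "\<And>o'. o' \<in> G \<Longrightarrow> filterlim (\<lambda>j. kobayashi G o' (u j)) at_top sequentially"
proof -
  note domG = strongly_completeD(1)[OF G]
  obtain c where c: "0 < c" "\<And>x y. x \<in> D \<Longrightarrow> y \<in> D \<Longrightarrow> c * dist x y \<le> kobayashi D x y"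
    using kobayashi_lower_bound[OF visibleD[OF D]] by blast
  \<comment> \<open>At a limit inside \<open>G\<close> the distance of \<open>z j\<close> and
    \<open>w j\<close> would tend to 0, while their images stay at Kobayashi distance at least
    \<open>c * \<epsilon>\<close>.\<close>
  have "p \<notin> G"
  proof
    assume p: "p \<in> G"
    have lim: "(\<lambda>j. kobayashi G p (v j)) \<longlonglongrightarrow> 0" if "\<And>j. v j \<in> G" "v \<longlonglongrightarrow> p" for v
      using continuous_on_tendsto_compose[OF continuous_on_kobayashi[OF domG p] that(2) p] that(1)
      by (simp add: kobayashi_refl[OF domG p])
    have "c * \<epsilon> \<le> kobayashi G p (z j) + kobayashi G p (w j)" for j
    proof -
      have "c * \<epsilon> \<le> c * dist (f j (z j)) (f j (w j))"
        using c(1) \<epsilon>(2) by simp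
      also have "\<dots> \<le> kobayashi D (f j (z j)) (f j (w j))"
        by (rule c(2)[OF kobayashi_isometryD(1)[OF f z(1)] kobayashi_isometryD(1)[OF f w(1)]])
      also have "\<dots> = kobayashi G (z j) (w j)"
        by (rule kobayashi_isometryD(2)[OF f z(1) w(1)])
      also have "\<dots> \<le> kobayashi G p (z j) + kobayashi G p (w j)"
        using kobayashi_triangle[OF domG z(1) p w(1)] kobayashi_sym[OF domG p z(1)] by simp
      finally show ?thesis .
    qed
    then have "c * \<epsilon> \<le> 0 + 0"
      by (intro LIMSEQ_le_const[OF tendsto_add[OF lim[OF z] lim[OF w]]]) simp
    then show False using c(1) \<epsilon>(1) by (simp add: mult_le_0_iff)
  qed
  moreover have "p \<in> closure G"
    using z closure_sequential by blast
  ultimately have p: "p \<in> frontier G"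
    using domain_frontier[OF domG] by blast
  define L where "L j = kobayashi G (z j) (w j)" for j
  have "\<exists>\<psi>. real_geodesic G 0 (L j) \<psi> \<and> \<psi> 0 = z j \<and> \<psi> (L j) = w j" for j
    unfolding L_def by (rule real_geodesic_exists[OF G z(1) w(1)]) blast
  then obtain \<psi> where \<psi>: "\<And>j. real_geodesic G 0 (L j) (\<psi> j)"
      and ends: "\<And>j. \<psi> j 0 = z j" "\<And>j. \<psi> j (L j) = w j"
    by metis
  \<comment> \<open>Visibility asks for a diameter strictly above the threshold, hence
    \<open>\<epsilon> / 2\<close>.\<close>
  obtain K where K: "relatively_compact_in K D"
    "\<And>a b \<psi>. real_geodesic D a b \<psi> \<Longrightarrow> diameter (\<psi> ` {a..b}) > \<epsilon> / 2 \<Longrightarrow> \<psi> ` {a..b} \<inter> K \<noteq> {}"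
    using D \<epsilon>(1) unfolding visible_def by (meson half_gt_zero)
  have "\<exists>u\<in>\<psi> j ` {0..L j}. f j u \<in> K" for j
  proof -
    let ?g = "f j \<circ> \<psi> j"
    have g: "real_geodesic D 0 (L j) ?g"
      by (rule kobayashi_isometry_real_geodesic[OF visibleD[OF D] f \<psi>])
    then have "0 \<le> L j" "bounded (?g ` {0..L j})"
      using bounded_subset[OF visibleD(2)[OF D]] by (auto simp: real_geodesic_def)
    then have "dist (?g 0) (?g (L j)) \<le> diameter (?g ` {0..L j})"
      by (intro diameter_bounded_bound) auto
    then have "\<epsilon> / 2 < diameter (?g ` {0..L j})"
      using \<epsilon>(2)[of j] \<epsilon>(1) by (simp add: ends)
    from K(2)[OF g this] show ?thesis by auto
  qed
  then obtain u where u: "\<And>j. u j \<in> \<psi> j ` {0..L j}" "\<And>j. f j (u j) \<in> K" by metis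
  have sub: "\<psi> j ` {0..L j} \<subseteq> G" for j
    using \<psi> by (simp add: real_geodesic_def)
  with u(1) have uG: "u j \<in> G" for j by blast
  obtain q where q: "q \<in> G"
    "filterlim (\<lambda>j. INF v \<in> \<psi> j ` {0..L j}. kobayashi G q v) at_top sequentially"
    using G[unfolded strongly_complete_def, THEN conjunct2, rule_format, OF p, of "\<lambda>_. 0" L \<psi>]
      \<psi> z(2) w(2) by (auto simp: ends)
  have "(INF v \<in> \<psi> j ` {0..L j}. kobayashi G q v) \<le> kobayashi G q (u j)" for j
    using u(1)[of j] sub[of j] kobayashi_nonneg[OF domG q(1)]
    by (intro cINF_lower bdd_belowI2[of _ 0]) auto
  with q(2) have "filterlim (\<lambda>j. kobayashi G q (u j)) at_top sequentially"
    by (rule filterlim_at_top_mono[OF _ always_eventually[OF allI]])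
  then have qlim: "filterlim (\<lambda>j. - kobayashi G q o' + kobayashi G q (u j)) at_top sequentially" for o'
    by (rule filterlim_tendsto_add_at_top[OF tendsto_const])
  have "filterlim (\<lambda>j. kobayashi G o' (u j)) at_top sequentially" if "o' \<in> G" for o'
    by (rule filterlim_at_top_mono[OF qlim[of o']])
       (use kobayashi_triangle[OF domG q(1) that uG] in \<open>simp add: algebra_simps\<close>)
  with that K(1) uG u(2) show ?thesis by blast
qed

text \<open>
  A point of a compact subset of \<open>G\<close> stays at bounded distance from a base point, hence far from
  \<open>u j\<close>; its image is thus far from a fixed compact subset of \<open>D\<close> and so close to the boundary.
\<close>

lemma SUP_boundary_dist_tendsto_0:
  fixes D :: "(complex ^ 'n) set"
  assumes G: "domain G" and D: "domain D" "bounded D"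
    and K: "K \<noteq> {}" "relatively_compact_in K G" and C: "relatively_compact_in C D"
    and f: "\<And>j::nat. kobayashi_isometry G D (f j)"
    and u: "\<And>j. u j \<in> G" "\<And>j. f j (u j) \<in> C"
    and lim: "\<And>o'. o' \<in> G \<Longrightarrow> filterlim (\<lambda>j. kobayashi G o' (u j)) at_top sequentially"
  shows "(\<lambda>j. SUP z\<in>K. boundary_dist D (f j z)) \<longlonglongrightarrow> 0"
proof (rule tendstoI)
  fix e :: real assume e: "0 < e"
  define \<eta> where "\<eta> = e / 2"
  have \<eta>: "0 < \<eta>" using e by (simp add: \<eta>_def)
  obtain o' where o: "o' \<in> K" using K(1) by blast
  note KG = relatively_compact_inD[OF K(2)] and CD = relatively_compact_inD[OF C]
  have oG: "o' \<in> G" using o KG by blast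
  obtain a where a: "a \<in> D" using D by (auto simp: domain_def)
  obtain B1 where B1: "\<And>x. x \<in> closure C \<Longrightarrow> kobayashi D a x \<le> B1"
    using kobayashi_bounded_on_compact[OF D(1) a CD(2,1)] by blast
  \<comment> \<open>Points of \<open>D\<close> at boundary distance at least \<open>\<eta>\<close>
    form a compact set, so their Kobayashi distance from \<open>a\<close> is bounded.\<close>
  obtain B2 where B2: "\<forall>x\<in>{y \<in> D. \<eta> \<le> boundary_dist D y}. kobayashi D a x \<le> B2"
    using kobayashi_bounded_on_compact[OF D(1) a compact_boundary_dist_ge[OF D \<eta>]] by auto
  obtain B3 where B3: "\<And>x. x \<in> closure K \<Longrightarrow> kobayashi G o' x \<le> B3"
    using kobayashi_bounded_on_compact[OF G oG KG(2,1)] by blast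
  have "\<forall>\<^sub>F j in sequentially. B1 + B2 + B3 < kobayashi G o' (u j)"
    using lim[OF oG] by (simp add: filterlim_at_top_dense)
  then show "\<forall>\<^sub>F j in sequentially. dist (SUP z\<in>K. boundary_dist D (f j z)) 0 < e"
  proof eventually_elim
    case (elim j)
    have le: "boundary_dist D (f j z) \<le> \<eta>" if z: "z \<in> K" for z
    proof (rule ccontr)
      assume contra: "\<not> ?thesis"
      have zG: "z \<in> G" using z KG by blast
      note fz = kobayashi_isometryD(1)[OF f zG, of j] and fu = kobayashi_isometryD(1)[OF f u(1), of j j]
      \<comment> \<open>The route from \<open>o'\<close> through \<open>z\<close> to
        \<open>u j\<close>, with its second leg transported to \<open>D\<close> and led through
        \<open>a\<close>, has length at most \<open>B3 + B2 + B1\<close>.\<close>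
      have "kobayashi G o' (u j) \<le> kobayashi G o' z + kobayashi G z (u j)"
        by (rule kobayashi_triangle[OF G oG zG u(1)])
      also have "kobayashi G z (u j) = kobayashi D (f j z) (f j (u j))"
        using kobayashi_isometryD(2)[OF f zG u(1)] by simp
      also have "\<dots> \<le> kobayashi D a (f j z) + kobayashi D a (f j (u j))"
        using kobayashi_triangle[OF D(1) fz a fu] kobayashi_sym[OF D(1) a fz] by simp
      also have "\<dots> \<le> B2 + B1"
      proof (rule add_mono)
        show "kobayashi D a (f j z) \<le> B2" using B2 fz contra by simp
        show "kobayashi D a (f j (u j)) \<le> B1" using B1 u(2) closure_subset by blast
      qed
      also have "kobayashi G o' z \<le> B3"
        using B3 z closure_subset by blast
      finally show False using elim by simp
    qed
    have "bdd_above ((\<lambda>z. boundary_dist D (f j z)) ` K)"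
      using kobayashi_isometryD(1)[OF f] KG by (intro bdd_above_boundary_dist[OF D]) blast
    then have "0 \<le> (SUP z\<in>K. boundary_dist D (f j z))"
      by (rule cSUP_upper2[OF _ o]) (rule boundary_dist_nonneg)
    moreover have "(SUP z\<in>K. boundary_dist D (f j z)) \<le> \<eta>"
      using K(1) le by (rule cSUP_least)
    ultimately show ?case using e by (simp add: \<eta>_def)
  qed
qed

lemma kobayashi_isometries_equicontinuous:
  fixes G :: "(complex ^ 'm) set" and D :: "(complex ^ 'n) set" and g :: "real \<Rightarrow> real"
  assumes G: "strongly_complete G" and D: "visible D"
    and K: "K \<noteq> {}" "relatively_compact_in K G"
    and g: "(g \<longlongrightarrow> 0) (at_right 0)"
  shows "uniformly_equicontinuous_on G
           {f. kobayashi_isometry G D f \<and>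
               (SUP z\<in>G. boundary_dist D (f z)) \<le> g (SUP z\<in>K. boundary_dist D (f z))}"
    (is "uniformly_equicontinuous_on G ?F")
proof (rule ccontr)
  note domG = strongly_completeD(1)[OF G] and domD = visibleD[OF D]
  assume "\<not> ?thesis"
  then obtain \<epsilon> where \<epsilon>: "0 < \<epsilon>"
    "\<And>\<delta>. 0 < \<delta> \<Longrightarrow> \<exists>f\<in>?F. \<exists>x\<in>G. \<exists>y\<in>G. dist x y < \<delta> \<and> \<epsilon> \<le> dist (f x) (f y)"
    unfolding uniformly_equicontinuous_on_def by (meson not_le)
  have "\<forall>j. \<exists>f x y. f \<in> ?F \<and> x \<in> G \<and> y \<in> G \<and> dist x y < inverse (real (Suc j)) \<and> \<epsilon> \<le> dist (f x) (f y)"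
    using \<epsilon>(2) by (meson inverse_positive_iff_positive of_nat_0_less_iff zero_less_Suc)
  then obtain f x y where fxy: "\<forall>j. f j \<in> ?F \<and> x j \<in> G \<and> y j \<in> G \<and>
      dist (x j) (y j) < inverse (real (Suc j)) \<and> \<epsilon> \<le> dist (f j (x j)) (f j (y j))"
    unfolding choice_iff by blast
  then have f: "f j \<in> ?F" and x: "x j \<in> G" and y: "y j \<in> G"
    and close: "dist (x j) (y j) < inverse (real (Suc j))"
    and far: "\<epsilon> \<le> dist (f j (x j)) (f j (y j))" for j
    by (simp_all only:)
  have "compact (closure G)" using strongly_completeD(2)[OF G] by simp
  moreover have "\<forall>j. x j \<in> closure G" using x closure_subset by blast
  ultimately obtain p \<sigma> where \<sigma>: "strict_mono \<sigma>" and xlim: "(x \<circ> \<sigma>) \<longlonglongrightarrow> p"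
    unfolding compact_def by metis
  have "(\<lambda>j. dist (x j) (y j)) \<longlonglongrightarrow> 0"
    using less_imp_le[OF close]
    by (intro tendsto_sandwich[OF _ _ tendsto_const LIMSEQ_inverse_real_of_nat]) simp_all
  from LIMSEQ_subseq_LIMSEQ[OF this \<sigma>]
  have "(\<lambda>j. (x \<circ> \<sigma>) j - (y \<circ> \<sigma>) j) \<longlonglongrightarrow> 0"
    by (simp add: dist_norm o_def tendsto_norm_zero_iff)
  with xlim have ylim: "(y \<circ> \<sigma>) \<longlonglongrightarrow> p" by (rule Lim_transform2)
  have iso: "kobayashi_isometry G D ((f \<circ> \<sigma>) j)" for j using f by simp
  have "(x \<circ> \<sigma>) j \<in> G" "(y \<circ> \<sigma>) j \<in> G" "\<epsilon> \<le> dist ((f \<circ> \<sigma>) j ((x \<circ> \<sigma>) j)) ((f \<circ> \<sigma>) j ((y \<circ> \<sigma>) j))" for j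
    using x y far by simp_all
  from visible_geodesic_points_escape[OF G D iso this(1) xlim this(2) ylim \<epsilon>(1) this(3)]
  obtain C u where C: "relatively_compact_in C D" and u: "\<And>j. u j \<in> G" "\<And>j. (f \<circ> \<sigma>) j (u j) \<in> C"
    and lim: "\<And>o'. o' \<in> G \<Longrightarrow> filterlim (\<lambda>j. kobayashi G o' (u j)) at_top sequentially"
    by blast
  define s where "s j = (SUP z\<in>K. boundary_dist D ((f \<circ> \<sigma>) j z))" for j
  have s0: "s \<longlonglongrightarrow> 0"
    unfolding s_def by (rule SUP_boundary_dist_tendsto_0[OF domG domD K C iso u lim])
  note KG = relatively_compact_inD(3)[OF K(2)]
  obtain o' where o: "o' \<in> K" "o' \<in> G"
    using K KG by blast
  have bdd: "bdd_above ((\<lambda>z. boundary_dist D ((f \<circ> \<sigma>) j z)) ` S)" if "S \<subseteq> G" for S j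
    using kobayashi_isometryD(1)[OF iso] that by (intro bdd_above_boundary_dist[OF domD]) blast
  \<comment> \<open>The limit of \<open>g\<close> is one-sided, so \<open>s\<close> must approach 0
    through positive values.\<close>
  have "0 < s j" for j
  proof -
    have "0 < boundary_dist D ((f \<circ> \<sigma>) j o')"
      by (rule boundary_dist_pos[OF domD kobayashi_isometryD(1)[OF iso o(2)]])
    also have "\<dots> \<le> s j"
      unfolding s_def by (rule cSUP_upper[OF o(1) bdd[OF KG]])
    finally show ?thesis .
  qed
  with s0 have "filterlim s (at_right 0) sequentially"
    by (intro tendsto_imp_filterlim_at_right) auto
  from filterlim_compose[OF g this] have gs: "(\<lambda>j. g (s j)) \<longlonglongrightarrow> 0" .
  note CD = relatively_compact_inD[OF C]
  have uC: "(f \<circ> \<sigma>) j (u j) \<in> closure C" for j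
    using closure_subset u(2) by blast
  then have "closure C \<noteq> {}" by fastforce
  \<comment> \<open>The minimum of \<open>boundary_dist D\<close> over the compact closure of
    \<open>C\<close> is a positive lower bound independent of \<open>j\<close>; the condition with
    \<open>g\<close> forces it to be at most 0.\<close>
  from continuous_attains_inf[OF CD(2) this continuous_on_boundary_dist]
  obtain v where v: "v \<in> closure C" "\<forall>y\<in>closure C. boundary_dist D v \<le> boundary_dist D y"
    by blast
  have "boundary_dist D v \<le> g (s j)" for j
  proof -
    have "boundary_dist D v \<le> boundary_dist D ((f \<circ> \<sigma>) j (u j))"
      using v(2) uC by blast
    also have "\<dots> \<le> (SUP z\<in>G. boundary_dist D ((f \<circ> \<sigma>) j z))"
      by (rule cSUP_upper[OF u(1) bdd[OF order_refl]])
    also have "\<dots> \<le> g (s j)" using f by (simp add: s_def)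
    finally show ?thesis .
  qed
  then have "boundary_dist D v \<le> 0"
    using LIMSEQ_le_const[OF gs] by blast
  with boundary_dist_pos[OF domD] v(1) CD(1) show False by fastforce
qed

text \<open>A single isometry belongs to such a family for a suitable \<open>g\<close> and a
  one-point \<open>K\<close>, so it is uniformly continuous and extends to the closure. Properness
  of the distance then sends frontier to frontier.\<close>

lemma kobayashi_isometry_extends:
  fixes G :: "(complex ^ 'm) set" and D :: "(complex ^ 'n) set"
  assumes G: "strongly_complete G" and D: "visible D" and f: "kobayashi_isometry G D f"
  obtains F where "continuous_on (closure G) F" "\<And>z. z \<in> G \<Longrightarrow> F z = f z"
    "F ` frontier G \<subseteq> frontier D"
proof -
  note domG = strongly_completeD(1)[OF G] and domD = visibleD[OF D]
  obtain o' where o: "o' \<in> G" using domG by (auto simp: domain_def)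
  note fo = kobayashi_isometryD(1)[OF f o]
  define S where "S = (SUP z\<in>G. boundary_dist D (f z))"
  \<comment> \<open>The linear function whose slope turns the required inequality into an equality
    for \<open>K = {o'}\<close>.\<close>
  define g where "g x = S / boundary_dist D (f o') * x" for x
  have pos: "0 < boundary_dist D (f o')" by (rule boundary_dist_pos[OF domD fo])
  have "(g \<longlongrightarrow> 0) (at_right 0)"
    unfolding g_def by (intro tendsto_mult_right_zero tendsto_ident_at)
  then have "uniformly_equicontinuous_on G
       {f. kobayashi_isometry G D f \<and>
           (SUP z\<in>G. boundary_dist D (f z)) \<le> g (SUP z\<in>{o'}. boundary_dist D (f z))}"
    using o by (intro kobayashi_isometries_equicontinuous[OF G D])
      (simp_all add: relatively_compact_in_def)
  moreover have "(SUP z\<in>G. boundary_dist D (f z)) \<le> g (SUP z\<in>{o'}. boundary_dist D (f z))"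
    using pos by (simp add: g_def flip: S_def)
  ultimately have "uniformly_continuous_on G f"
    using f unfolding uniformly_equicontinuous_on_def uniformly_continuous_on_def
    by (metis (mono_tags, lifting) dist_commute mem_Collect_eq)
  from uniformly_continuous_on_extension_on_closure[OF this] obtain F
    where F: "uniformly_continuous_on (closure G) F" "\<And>z. z \<in> G \<Longrightarrow> f z = F z"
    by metis
  have cont: "continuous_on (closure G) F"
    by (rule uniformly_continuous_imp_continuous[OF F(1)])
  have "F p \<in> frontier D" if p: "p \<in> frontier G" for p
  proof -
    have pc: "p \<in> closure G" using p domain_frontier[OF domG] by blast
    then obtain z where z: "\<And>j. z j \<in> G" "z \<longlonglongrightarrow> p"
      unfolding closure_sequential by blast
    have fz: "f (z j) \<in> D" for j by (rule kobayashi_isometryD(1)[OF f z(1)])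
    have "(\<lambda>j. F (z j)) \<longlonglongrightarrow> F p"
      using continuous_on_tendsto_compose[OF cont z(2) pc] z(1) closure_subset[of G]
      by (simp add: subset_iff)
    then have lim: "(\<lambda>j. f (z j)) \<longlonglongrightarrow> F p" using F(2) z(1) by simp
    \<comment> \<open>Were \<open>F p\<close> in \<open>D\<close>, the distances from
      \<open>f o'\<close> to \<open>f (z j)\<close> would converge; they equal the distances from
      \<open>o'\<close> to \<open>z j\<close>, which diverge.\<close>
    have "F p \<notin> D"
    proof
      assume "F p \<in> D"
      then have "(\<lambda>j. kobayashi D (f o') (f (z j))) \<longlonglongrightarrow> kobayashi D (f o') (F p)"
        using continuous_on_tendsto_compose[OF continuous_on_kobayashi[OF domD(1) fo] lim] fz by simp
      then have "(\<lambda>j. kobayashi G o' (z j)) \<longlonglongrightarrow> kobayashi D (f o') (F p)"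
        using kobayashi_isometryD(2)[OF f o z(1)] by simp
      moreover have "filterlim (\<lambda>j. kobayashi G o' (z j)) at_infinity sequentially"
        by (rule filterlim_at_top_imp_at_infinity[OF kobayashi_at_top_at_frontier[OF G o p z]])
      ultimately show False
        using not_tendsto_and_filterlim_at_infinity[OF sequentially_bot] by blast
    qed
    moreover have "F p \<in> closure D"
      unfolding closure_sequential using fz lim by (intro exI[of _ "\<lambda>j. f (z j)"]) simp
    ultimately show ?thesis using domain_frontier[OF domD(1)] by blast
  qed
  with that[OF cont] F(2) show ?thesis by fastforce
qed

theorem proposition4:
  fixes G :: "(complex ^ 'm) set" and D :: "(complex ^ 'n) set"
  assumes "strongly_complete G" and "visible D"
  shows "(\<forall>K (g :: real \<Rightarrow> real).
            K \<noteq> {} \<and> relatively_compact_in K G \<and>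
            (\<forall>x>0. g x > 0) \<and> (g \<longlongrightarrow> 0) (at_right 0) \<longrightarrow>
            uniformly_equicontinuous_on G
              {f. kobayashi_isometry G D f \<and>
                  (SUP z\<in>G. boundary_dist D (f z)) \<le> g (SUP z\<in>K. boundary_dist D (f z))})
       \<and> (\<forall>f. kobayashi_isometry G D f \<longrightarrow>
            (\<exists>F. continuous_on (closure G) F \<and> (\<forall>z\<in>G. F z = f z) \<and>
                 F ` frontier G \<subseteq> frontier D))"
proof (intro conjI allI impI)
  fix K and g :: "real \<Rightarrow> real"
  assume "K \<noteq> {} \<and> relatively_compact_in K G \<and> (\<forall>x>0. g x > 0) \<and> (g \<longlongrightarrow> 0) (at_right 0)"
  then show "uniformly_equicontinuous_on G
      {f. kobayashi_isometry G D f \<and>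
          (SUP z\<in>G. boundary_dist D (f z)) \<le> g (SUP z\<in>K. boundary_dist D (f z))}"
    by (intro kobayashi_isometries_equicontinuous[OF assms]) simp_all
next
  fix f assume "kobayashi_isometry G D f"
  from kobayashi_isometry_extends[OF assms this]
  show "\<exists>F. continuous_on (closure G) F \<and> (\<forall>z\<in>G. F z = f z) \<and> F ` frontier G \<subseteq> frontier D"
    by metis
qed

end
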